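(* Let $0\le\lambda\le 1$ and $|\epsilon|=1$. Let $f=h+\overline{g}$ be harmonic in $\mathbb{D}$, where $h(z)=z+\sum_{n=2}^{\infty}a_nz^n$ and $g(z)=\sum_{n=2}^{\infty}b_nz^n$, and suppose that for all $n\ge 2$ $$|a_n|\le \tfrac16(2n+1)(n+1),\qquad |b_n|\le \tfrac16(2n-1)(n-1),\qquad \big||a_n|-|b_n|\big|\le n .$$ Then the radius of fully starlikeness for $F(z)=(1-\lambda)f+\lambda D_f^{\epsilon}$ is at least $r_s$, where $r_s$ is the root in the interval $(0,1)$ of the equation $$1-(11+6 \lambda ) r+(21-8 \lambda ) r^2-(19+2 \lambda ) r^3+10 r^4-2 r^5=0 .$$
   Context: $\mathbb{D}=\{z\in\mathbb{C}:|z|<1\}$. $\mathcal{H}$ is the class of complex-valued harmonic functions $f=h+\overline g$ on $\mathbb{D}$ with $h,g$ analytic in $\mathbb{D}$, $h(0)=g(0)=0$, $h'(0)=1$. $\mathcal{S}_H$ is the class of univalent sense-preserving $f\in\mathcal{H}$ (sense-preserving: $|g'(z)|<|h'(z)|$ in $\mathbb{D}$). For $f=h+\overline g$ and $|\epsilon|=1$, $D_f^{\epsilon}(z)=zf_z-\epsilon\,\overline z f_{\overline z}=zh'(z)-\epsilon\,\overline{zg'(z)}$. A function $F\in\mathcal{S}_H$ is fully starlike (in $\mathbb{D}$) if it maps every circle $|z|=r<1$ in a one-to-one manner onto a curve satisfying $\frac{\partial}{\partial\theta}\arg F(re^{i\theta})>0$ for $0\le\theta<2\pi$, $0<r<1$.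 $F$ is fully starlike in $|z|<r$ ($0<r<1$) if $F_r(z)=r^{-1}F(rz)$ is fully starlike in $\mathbb{D}$. The radius of fully starlikeness being at least $\rho$ means that $F$ is fully starlike in $|z|<\rho$ for every $f$ satisfying the hypotheses. *)

theory Defs
  imports "HOL-Complex_Analysis.Complex_Analysis"
begin

abbreviation unit_disk :: "complex set" where
  "unit_disk \<equiv> ball 0 1"

text \<open>\<open>harmonic_rep f h g\<close>: the function \<open>f\<close> belongs to the class \<open>\<H>\<close> of normalized
  harmonic functions, with analytic part \<open>h\<close> and co-analytic part \<open>g\<close>.
  Only values on the unit disk matter.\<close>

definition harmonic_rep ::
    "(complex \<Rightarrow> complex) \<Rightarrow> (complex \<Rightarrow> complex) \<Rightarrow> (complex \<Rightarrow> complex) \<Rightarrow> bool" where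
  "harmonic_rep f h g \<longleftrightarrow>
     h holomorphic_on unit_disk \<and> g holomorphic_on unit_disk \<and>
     h 0 = 0 \<and> g 0 = 0 \<and> deriv h 0 = 1 \<and>
     (\<forall>z\<in>unit_disk. f z = h z + cnj (g z))"

definition class_S_H :: "(complex \<Rightarrow> complex) set" where
  "class_S_H = {f. inj_on f unit_disk \<and>
     (\<exists>h g. harmonic_rep f h g \<and>
            (\<forall>z\<in>unit_disk. cmod (deriv g z) < cmod (deriv h z)))}"

text \<open>Wirtinger derivatives \<open>f\<^sub>z = (f\<^sub>x - i f\<^sub>y) / 2\<close> and
  \<open>f\<^bsub>z\<^sup>*\<^esub> = (f\<^sub>x + i f\<^sub>y) / 2\<close>, the partial derivatives being the values of the real
  Frechet derivative in the directions \<open>1\<close> and \<open>i\<close>.\<close>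

definition wirtinger_z :: "(complex \<Rightarrow> complex) \<Rightarrow> complex \<Rightarrow> complex" where
  "wirtinger_z f z =
     (frechet_derivative f (at z) 1 - \<i> * frechet_derivative f (at z) \<i>) / 2"

definition wirtinger_zbar :: "(complex \<Rightarrow> complex) \<Rightarrow> complex \<Rightarrow> complex" where
  "wirtinger_zbar f z =
     (frechet_derivative f (at z) 1 + \<i> * frechet_derivative f (at z) \<i>) / 2"

definition D_op :: "complex \<Rightarrow> (complex \<Rightarrow> complex) \<Rightarrow> complex \<Rightarrow> complex" where
  "D_op \<epsilon> f z = z * wirtinger_z f z - \<epsilon> * cnj z * wirtinger_zbar f z"

text \<open>\<open>d\<close> is the derivative at \<open>t\<close> of the argument of the curve \<open>\<gamma>\<close>. As the principal
  argument jumps, this refers to an arbitrary branch of the argument near \<open>t\<close>. Any two branches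
  differentiable at \<open>t\<close> differ near \<open>t\<close> by a constant, so \<open>d\<close> does not depend on the branch.\<close>

definition has_arg_derivative :: "(real \<Rightarrow> complex) \<Rightarrow> real \<Rightarrow> real \<Rightarrow> bool" where
  "has_arg_derivative \<gamma> d t \<longleftrightarrow>
     (\<exists>\<phi>. (\<forall>\<^sub>F s in nhds t. \<gamma> s \<noteq> 0 \<and> \<gamma> s = of_real (cmod (\<gamma> s)) * cis (\<phi> s)) \<and>
          (\<phi> has_real_derivative d) (at t))"

definition fully_starlike :: "(complex \<Rightarrow> complex) \<Rightarrow> bool" where
  "fully_starlike F \<longleftrightarrow> F \<in> class_S_H \<and>
     (\<forall>r. 0 < r \<and> r < 1 \<longrightarrow>
        inj_on F (sphere 0 r) \<and>
        (\<forall>\<theta>\<in>{0..<2 * pi}. \<exists>d>0.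
           has_arg_derivative (\<lambda>t. F (of_real r * cis t)) d \<theta>))"

definition fully_starlike_in :: "real \<Rightarrow> (complex \<Rightarrow> complex) \<Rightarrow> bool" where
  "fully_starlike_in r F \<longleftrightarrow>
     0 < r \<and> r < 1 \<and> fully_starlike (\<lambda>z. F (of_real r * z) / of_real r)"

definition radius_poly :: "real \<Rightarrow> real \<Rightarrow> real" where
  "radius_poly lam r =
     1 - (11 + 6 * lam) * r + (21 - 8 * lam) * r ^ 2 - (19 + 2 * lam) * r ^ 3
       + 10 * r ^ 4 - 2 * r ^ 5"

lemma D_op_harmonic_rep:
  assumes "harmonic_rep f h g" and z: "z \<in> unit_disk"
  shows "D_op \<epsilon> f z = z * deriv h z - \<epsilon> * cnj (z * deriv g z)"
proof -
  have h: "(h has_field_derivative deriv h z) (at z)"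
    and g: "(g has_field_derivative deriv g z) (at z)"
    using assms unfolding harmonic_rep_def by (auto intro!: holomorphic_derivI[of _ unit_disk])
  have "((\<lambda>w. h w + cnj (g w)) has_derivative (\<lambda>w. deriv h z * w + cnj (deriv g z * w))) (at z)"
    using h g unfolding has_field_derivative_def by (intro derivative_intros) auto
  then have "(f has_derivative (\<lambda>w. deriv h z * w + cnj (deriv g z * w))) (at z)"
    by (rule has_derivative_transform_within_open[of _ _ _ _ unit_disk])
       (use assms in \<open>auto simp: harmonic_rep_def\<close>)
  then have "frechet_derivative f (at z) = (\<lambda>w. deriv h z * w + cnj (deriv g z * w))"
    by (rule frechet_derivative_at[symmetric])
  then show ?thesis
    by (simp add: D_op_def wirtinger_z_def wirtinger_zbar_def field_simps)
qed

end

theory Submission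
  imports Defs
begin

text \<open>
  Write the rescaled function as \<open>F (r z) / r = z + p z + cnj (q z)\<close>, where \<open>p\<close> and \<open>q\<close> are power
  series with coefficients \<open>c n\<close> and \<open>d n\<close> that start at \<open>n = 2\<close>. If \<open>\<Sum>n (|c n| + |d n|) \<le> 1\<close>, then
  the perturbation \<open>p + cnj q\<close> of the identity is so small that the function is fully starlike:
  the sum dominates the derivative of the perturbation, which gives univalence and sense
  preservation, and it also bounds the rotation of the image of a circle, because
  \<open>(n - 1) + (n + 1) = 2 n\<close> (lemma \<open>fully_starlike_if_coeff_sum_le_1\<close>).

  The operator \<open>(1 - \<lambda>) f + \<lambda> D f\<close> multiplies the coefficients of index \<open>n\<close> by factors of modulus at most
  \<open>1 - \<lambda> + \<lambda> n\<close>, and the hypotheses give \<open>|a n| + |b n| \<le> (2 n\<^sup>2 + 1) / 3\<close>. So the sum above is at most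
  \<open>\<Sum>n\<ge>2. n (1 - \<lambda> + \<lambda> n) (2 n\<^sup>2 + 1) / 3 \<cdot> r\<^bsup>n - 1\<^esup>\<close>. This series is elementary, and its value is
  \<open>1 - P(r) / (1 - r)\<^sup>5\<close> with \<open>P\<close> the polynomial of the theorem (lemma \<open>majorant_sums\<close>): it
  equals \<open>1\<close>, the value permitted by the criterion, exactly at the roots of \<open>P\<close>. As the coefficients of the
  series are nonnegative, its value increases strictly with \<open>r\<close>, so the root is unique.
\<close>

section \<open>The majorant series and the radius polynomial\<close>

text \<open>
  The operator \<open>f \<mapsto> z f'\<close> multiplies the coefficient of \<open>z\<^sup>n\<close> by \<open>n\<close>. It is used over the reals to sum
  the majorant, and over the complex numbers to expand \<open>z h'\<close> and \<open>z g'\<close>.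
\<close>

lemma euler_operator_sums:
  fixes c :: "nat \<Rightarrow> 'a::{real_normed_field,banach}"
  assumes "\<And>z. norm z < 1 \<Longrightarrow> (\<lambda>n. c n * z ^ n) sums f z"
    and "(f has_field_derivative D) (at z)" and "norm z < 1"
  shows "(\<lambda>n. of_nat n * c n * z ^ n) sums (z * D)"
proof -
  have "(\<lambda>n. diffs c n * z ^ n) sums D"
    by (rule termdiffs_sums_strong[OF assms])
  then have "(\<lambda>n. z * (diffs c n * z ^ n)) sums (z * D)"
    by (rule sums_mult)
  then have "(\<lambda>n. of_nat (Suc n) * c (Suc n) * z ^ Suc n) sums (z * D)"
    by (simp add: diffs_def mult_ac)
  then show ?thesis
    by (subst (asm) sums_Suc_iff) simp
qed

text \<open>
  The sums result from the geometric series by repeated application of the operator \<open>x \<cdot> d/dx\<close>, which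
  introduces one factor \<open>n\<close> each time. They are the parts of the majorant for \<open>\<lambda> = 0\<close> and \<open>\<lambda> = 1\<close>.
\<close>

lemma weighted_sums:
  fixes x :: real
  assumes "\<bar>x\<bar> < 1"
  shows "(\<lambda>n. real n * (2 * real n ^ 2 + 1) / 3 * x ^ n) sums (x * (1 + x) ^ 2 / (1 - x) ^ 4)"
    (is "?A x")
    and "(\<lambda>n. real n ^ 2 * (2 * real n ^ 2 + 1) / 3 * x ^ n)
           sums (x * (1 + x) * (1 + 6 * x + x ^ 2) / (1 - x) ^ 5)"
proof -
  have nz: "1 - z \<noteq> 0" if "norm z < 1" for z :: real
    using that by auto
  have s0: "(\<lambda>n. 1 * z ^ n) sums (1 / (1 - z))" if "norm z < 1" for z :: real
    using geometric_sums[OF that] by simp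
  have s1: "(\<lambda>n. real n * z ^ n) sums (z / (1 - z) ^ 2)" if "norm z < 1" for z :: real
  proof -
    have "((\<lambda>z. 1 / (1 - z)) has_field_derivative 1 / (1 - z) ^ 2) (at z)"
      using nz[OF that] by (auto intro!: derivative_eq_intros simp: power2_eq_square)
    from euler_operator_sums[OF s0 this that] show ?thesis by simp
  qed
  have s2: "(\<lambda>n. real n * real n * z ^ n) sums (z * (1 + z) / (1 - z) ^ 3)"
    if "norm z < 1" for z :: real
  proof -
    have "((\<lambda>z. z / (1 - z) ^ 2) has_field_derivative (1 + z) / (1 - z) ^ 3) (at z)"
      using nz[OF that]
      by (auto intro!: derivative_eq_intros simp: divide_simps) (simp add: field_simps power_numeral_reduce)
    from euler_operator_sums[OF s1 this that] show ?thesis by simp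
  qed
  have s3: "(\<lambda>n. real n * (real n * real n) * z ^ n) sums (z * ((1 + 4 * z + z ^ 2) / (1 - z) ^ 4))"
    if "norm z < 1" for z :: real
  proof -
    have "((\<lambda>z. z * (1 + z) / (1 - z) ^ 3) has_field_derivative (1 + 4 * z + z ^ 2) / (1 - z) ^ 4) (at z)"
      using nz[OF that]
      by (auto intro!: derivative_eq_intros simp: divide_simps) (simp add: field_simps power_numeral_reduce)
    from euler_operator_sums[OF s2 this that] show ?thesis by simp
  qed
  have A: "?A z" if "norm z < 1" for z :: real
  proof -
    have "(\<lambda>n. 2 / 3 * (real n * (real n * real n) * z ^ n) + 1 / 3 * (real n * z ^ n)) sums
        (2 / 3 * (z * ((1 + 4 * z + z ^ 2) / (1 - z) ^ 4)) + 1 / 3 * (z / (1 - z) ^ 2))"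
      by (intro sums_add sums_mult s1 s3 that)
    moreover have "2 / 3 * (z * ((1 + 4 * z + z ^ 2) / (1 - z) ^ 4)) + 1 / 3 * (z / (1 - z) ^ 2)
        = z * (1 + z) ^ 2 / (1 - z) ^ 4"
      using nz[OF that] by (simp add: divide_simps) (simp add: algebra_simps power_numeral_reduce)
    ultimately show ?thesis
      by (simp add: field_simps power2_eq_square)
  qed
  then show "?A x" using assms by simp
  have "((\<lambda>x. x * (1 + x) ^ 2 / (1 - x) ^ 4) has_field_derivative
      (1 + x) * (1 + 6 * x + x ^ 2) / (1 - x) ^ 5) (at x)"
    using nz[of x] assms
    by (auto intro!: derivative_eq_intros simp: divide_simps) (simp add: field_simps power_numeral_reduce)
  from euler_operator_sums[OF A this] assms
  show "(\<lambda>n. real n ^ 2 * (2 * real n ^ 2 + 1) / 3 * x ^ n)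
           sums (x * (1 + x) * (1 + 6 * x + x ^ 2) / (1 - x) ^ 5)"
    by (simp add: power2_eq_square mult.assoc)
qed

text \<open>
  The factors are \<open>n\<close> from the coefficient criterion, \<open>1 - \<lambda> + \<lambda> n\<close> from the operator applied to \<open>f\<close>, and
  \<open>(2 n\<^sup>2 + 1) / 3\<close>, which is the sum of the assumed bounds on \<open>|a n|\<close> and \<open>|b n|\<close>.
\<close>

definition majorant :: "real \<Rightarrow> nat \<Rightarrow> real" where
  "majorant lam n = (if n < 2 then 0 else real n * (1 - lam + lam * real n) * (2 * real n ^ 2 + 1) / 3)"

lemma majorant_nonneg:
  assumes "0 \<le> lam" "lam \<le> 1"
  shows "0 \<le> majorant lam n"
  using assms by (auto simp: majorant_def)

text \<open>
  This is the source of the radius polynomial. The two closed forms are added with weights \<open>1 - \<lambda>\<close> and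
  \<open>\<lambda>\<close>; subtracting the term \<open>r\<close> of index \<open>1\<close> and reducing to the denominator \<open>(1 - r)\<^sup>5\<close> leaves \<open>radius_poly\<close>
  in the numerator. At a root \<open>r\<close> the sum is therefore \<open>r\<close>.
\<close>

lemma majorant_sums:
  assumes "\<bar>r\<bar> < 1"
  shows "(\<lambda>n. majorant lam n * r ^ n) sums (r * (1 - radius_poly lam r / (1 - r) ^ 5))"
proof -
  let ?w = "\<lambda>n. real n * (1 - lam + lam * real n) * (2 * real n ^ 2 + 1) / 3"
  have nz: "1 - r \<noteq> 0" using assms by auto
  have "(\<lambda>n. (1 - lam) * (real n * (2 * real n ^ 2 + 1) / 3 * r ^ n)
           + lam * (real n ^ 2 * (2 * real n ^ 2 + 1) / 3 * r ^ n)) sums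
        ((1 - lam) * (r * (1 + r) ^ 2 / (1 - r) ^ 4)
           + lam * (r * (1 + r) * (1 + 6 * r + r ^ 2) / (1 - r) ^ 5))"
    by (intro sums_add sums_mult weighted_sums assms)
  moreover have "(1 - lam) * (real n * (2 * real n ^ 2 + 1) / 3 * r ^ n)
           + lam * (real n ^ 2 * (2 * real n ^ 2 + 1) / 3 * r ^ n) = ?w n * r ^ n" for n
    by (simp add: field_simps power2_eq_square)
  ultimately have "(\<lambda>n. ?w n * r ^ n) sums
        ((1 - lam) * (r * (1 + r) ^ 2 / (1 - r) ^ 4)
           + lam * (r * (1 + r) * (1 + 6 * r + r ^ 2) / (1 - r) ^ 5))"
    by (simp only:)
  moreover have "(\<lambda>n. if n = 1 then r else 0) sums r"
    by (rule sums_single)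
  ultimately have "(\<lambda>n. ?w n * r ^ n - (if n = 1 then r else 0)) sums
        ((1 - lam) * (r * (1 + r) ^ 2 / (1 - r) ^ 4)
           + lam * (r * (1 + r) * (1 + 6 * r + r ^ 2) / (1 - r) ^ 5) - r)"
    by (rule sums_diff)
  moreover have "?w n * r ^ n - (if n = 1 then r else 0) = majorant lam n * r ^ n" for n
  proof -
    consider "n = 0" | "n = 1" | "n \<ge> 2" by linarith
    then show ?thesis by cases (auto simp: majorant_def)
  qed
  moreover have "(1 - lam) * (r * (1 + r) ^ 2 / (1 - r) ^ 4)
           + lam * (r * (1 + r) * (1 + 6 * r + r ^ 2) / (1 - r) ^ 5) - r
       = r * (1 - radius_poly lam r / (1 - r) ^ 5)"
    using nz unfolding radius_poly_def
    by (simp add: divide_simps) (simp add: algebra_simps power_numeral_reduce)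
  ultimately show ?thesis by simp
qed

text \<open>
  Existence is a sign change on \<open>[0, 1/2]\<close>; the endpoint \<open>1\<close> would not do, since the polynomial
  vanishes there for \<open>\<lambda> = 0\<close>. The polynomial need not be monotone on \<open>(0, 1)\<close>, so uniqueness is read off
  the majorant: it contains only powers of exponent at least \<open>2\<close>, so passing from \<open>y\<close> to a smaller
  \<open>x\<close> shrinks its sum by at least the factor \<open>(x / y)\<^sup>2\<close>, whereas at roots the sums are \<open>x\<close> and \<open>y\<close>.
\<close>

lemma radius_poly_unique_root:
  assumes "0 \<le> lam" "lam \<le> 1"
  shows "\<exists>!r. 0 < r \<and> r < 1 \<and> radius_poly lam r = 0"
proof -
  have "\<exists>r\<ge>0. r \<le> 1/2 \<and> radius_poly lam r = 0"
  proof (rule IVT2')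
    show "radius_poly lam (1/2) \<le> 0"
      using assms by (simp add: radius_poly_def field_simps)
    show "continuous_on {0..1/2} (radius_poly lam)"
      unfolding radius_poly_def by (intro continuous_intros)
  qed (auto simp: radius_poly_def)
  moreover have "radius_poly lam 0 \<noteq> 0" by (simp add: radius_poly_def)
  ultimately obtain r where "0 < r" "r < 1" "radius_poly lam r = 0"
    by (metis less_eq_real_def field_sum_of_halves le_less_trans less_add_same_cancel1 zero_less_one half_gt_zero)
  moreover have False
    if "0 < x" "x < y" "y < 1" "radius_poly lam x = 0" "radius_poly lam y = 0" for x y
  proof -
    have sx: "(\<lambda>n. majorant lam n * x ^ n) sums x"
      using majorant_sums[of x lam] that by simp
    have "(\<lambda>n. majorant lam n * y ^ n) sums y"
      using majorant_sums[of y lam] that by simp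
    then have sy: "(\<lambda>n. (x / y) ^ 2 * (majorant lam n * y ^ n)) sums ((x / y) ^ 2 * y)"
      by (rule sums_mult)
    have "majorant lam n * x ^ n \<le> (x / y) ^ 2 * (majorant lam n * y ^ n)" for n
    proof (cases "n < 2")
      case False
      have "(x / y) ^ n \<le> (x / y) ^ 2"
        using that False by (intro power_decreasing) auto
      then have "(x / y) ^ n * y ^ n \<le> (x / y) ^ 2 * y ^ n"
        using that by (intro mult_right_mono) auto
      then have "x ^ n \<le> (x / y) ^ 2 * y ^ n"
        using that by (simp add: power_divide)
      then show ?thesis
        using mult_left_mono[OF _ majorant_nonneg[OF assms, of n]] by (simp add: mult.left_commute)
    qed (simp add: majorant_def)
    from sums_le[OF this sx sy] have "x \<le> x * (x / y)"
      using that by (simp add: power2_eq_square)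
    then show False
      using that by (simp add: field_simps)
  qed
  ultimately show ?thesis
    by (metis linorder_neqE_linordered_idom)
qed

section \<open>A coefficient criterion for full starlikeness\<close>

text \<open>
  The logarithmic derivative of a curve has the derivative of the argument as its imaginary part.
  Dividing by \<open>\<gamma> t\<close> moves the curve near \<open>1\<close>, away from the branch cut of \<open>Ln\<close>.
\<close>

lemma has_arg_derivativeI:
  assumes \<gamma>: "(\<gamma> has_vector_derivative \<gamma>') (at t)" and nz: "\<gamma> t \<noteq> 0"
  shows "has_arg_derivative \<gamma> (Im (\<gamma>' / \<gamma> t)) t"
  unfolding has_arg_derivative_def
proof (intro exI conjI)
  let ?\<phi> = "\<lambda>s. Arg (\<gamma> t) + Im (Ln (\<gamma> s / \<gamma> t))"
  have "isCont \<gamma> t"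
    using \<gamma> by (rule has_vector_derivative_continuous)
  then have "\<forall>\<^sub>F s in at t. \<gamma> s \<noteq> 0"
    using nz by (simp add: isCont_def tendsto_imp_eventually_ne)
  then have "\<forall>\<^sub>F s in nhds t. \<gamma> s \<noteq> 0"
    using nz by (simp add: eventually_nhds_conv_at)
  then show "\<forall>\<^sub>F s in nhds t. \<gamma> s \<noteq> 0 \<and> \<gamma> s = of_real (cmod (\<gamma> s)) * cis (?\<phi> s)"
  proof eventually_elim
    case (elim s)
    have "\<gamma> s = \<gamma> t * exp (Ln (\<gamma> s / \<gamma> t))"
      using elim nz by simp
    also have "exp (Ln (\<gamma> s / \<gamma> t)) = of_real (cmod (\<gamma> s / \<gamma> t)) * cis (Im (Ln (\<gamma> s / \<gamma> t)))"
      using elim nz by (subst exp_eq_polar) (simp flip: norm_exp_eq_Re)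
    also have "\<gamma> t * \<dots> = (of_real (cmod (\<gamma> t)) * cis (Arg (\<gamma> t))) * \<dots>"
      by (metis rcis_cmod_Arg rcis_def)
    also have "\<dots> = of_real (cmod (\<gamma> s)) * cis (?\<phi> s)"
      using nz by (simp add: norm_divide flip: cis_mult)
    finally show ?case
      using elim by blast
  qed
  have "((\<lambda>s. \<gamma> s / \<gamma> t) has_vector_derivative \<gamma>' / \<gamma> t) (at t)"
    using \<gamma> by (rule has_vector_derivative_divide)
  moreover have "(Ln has_field_derivative 1) (at (\<gamma> t / \<gamma> t))"
    using nz by (auto intro!: derivative_eq_intros)
  ultimately have "(Ln \<circ> (\<lambda>s. \<gamma> s / \<gamma> t) has_vector_derivative \<gamma>' / \<gamma> t * 1) (at t)"
    by (rule field_vector_diff_chain_at)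
  then have "((\<lambda>s. Im (Ln (\<gamma> s / \<gamma> t))) has_vector_derivative Im (\<gamma>' / \<gamma> t)) (at t)"
    by (intro bounded_linear.has_vector_derivative[OF bounded_linear_Im]) (simp add: o_def)
  then show "(?\<phi> has_real_derivative Im (\<gamma>' / \<gamma> t)) (at t)"
    by (auto simp: has_real_derivative_iff_has_vector_derivative intro!: derivative_eq_intros)
qed

text \<open>
  In the first bound the two left-hand terms are estimated by \<open>\<Sum>(n - 1) |c n| |z|\<^sup>n\<close> and
  \<open>\<Sum>(n + 1) |c n| |z|\<^sup>n\<close>. Adding them before anything else is estimated leaves the weight \<open>2 n\<close>; bounding
  each one by a multiple of \<open>C\<close> would give the constant \<open>1 + 3/2\<close>, too large for the criterion below. The surplus powers of \<open>|z|\<close> come from the absence of a linear term and later turn the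
  non-strict condition on the coefficients into strict inequalities.
\<close>

lemma power_series_Euler_bounds:
  fixes c :: "nat \<Rightarrow> complex"
  assumes p: "\<And>z. norm z < 1 \<Longrightarrow> (\<lambda>n. c n * z ^ n) sums p z"
    and c: "c 0 = 0" "c 1 = 0"
    and C: "(\<lambda>n. real n * cmod (c n)) sums C"
    and z: "norm z < 1"
  shows "cmod (z * deriv p z - p z) + cmod (z * deriv p z + p z) \<le> 2 * C * cmod z ^ 2"
    and "cmod (deriv p z) \<le> C * cmod z"
proof -
  have "p holomorphic_on unit_disk"
    by (rule power_series_holomorphic[of _ _ c]) (use p in simp)
  then have D: "(p has_field_derivative deriv p z) (at z)" if "norm z < 1" for z
    using that by (auto intro: holomorphic_derivI)
  have sD: "(\<lambda>n. of_nat n * c n * z ^ n) sums (z * deriv p z)"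
    by (rule euler_operator_sums[OF p D[OF z] z])
  have term_le: "norm (of_nat n * c n * z ^ n) \<le> real n * cmod (c n) * cmod z ^ 2" for n
  proof (cases "n < 2")
    case True
    then have "c n = 0" using c less_2_cases by force
    then show ?thesis by simp
  next
    case False
    then have "cmod z ^ n \<le> cmod z ^ 2"
      using z by (intro power_decreasing) auto
    then show ?thesis
      by (auto simp: norm_mult norm_power intro!: mult_left_mono)
  qed
  have Cz: "(\<lambda>n. real n * cmod (c n) * cmod z ^ 2) sums (C * cmod z ^ 2)"
    using C by (rule sums_mult2)
  have bound: "norm s \<le> t"
    if "u sums s" "v sums t" "\<And>n. norm (u n) \<le> v n" for u :: "nat \<Rightarrow> complex" and v s t
    using norm_suminf_le[OF that(3) sums_summable[OF that(2)]] that(1,2) by (simp add: sums_iff)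
  have ssum: "summable (\<lambda>n. real n * cmod (c n) * cmod z ^ n)"
    by (rule summable_comparison_test'[OF sums_summable[OF Cz], of 0])
       (use term_le in \<open>simp add: norm_mult norm_power\<close>)
  have le: "cmod (c n) \<le> real n * cmod (c n)" for n
    using c(1) by (cases n) (auto simp: mult_le_cancel_right1)
  have ssum0: "summable (\<lambda>n. cmod (c n) * cmod z ^ n)"
    by (rule summable_comparison_test'[OF ssum, of 0])
       (auto intro!: mult_right_mono le)
  have "cmod (z * deriv p z - p z) \<le>
      (\<Sum>n. real n * cmod (c n) * cmod z ^ n) - (\<Sum>n. cmod (c n) * cmod z ^ n)"
  proof (rule bound[OF sums_diff[OF sD p[OF z]] sums_diff[OF summable_sums[OF ssum] summable_sums[OF ssum0]]])
    fix n
    show "cmod (of_nat n * c n * z ^ n - c n * z ^ n) \<le>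
        real n * cmod (c n) * cmod z ^ n - cmod (c n) * cmod z ^ n"
    proof (cases n)
      case (Suc m)
      have "of_nat n * c n * z ^ n - c n * z ^ n = of_nat m * c n * z ^ n"
        by (simp add: Suc algebra_simps)
      then show ?thesis by (simp add: norm_mult norm_power) (simp add: Suc algebra_simps)
    qed (simp add: c)
  qed
  moreover have "cmod (z * deriv p z + p z) \<le>
      (\<Sum>n. real n * cmod (c n) * cmod z ^ n) + (\<Sum>n. cmod (c n) * cmod z ^ n)"
    by (rule bound[OF sums_add[OF sD p[OF z]] sums_add[OF summable_sums[OF ssum] summable_sums[OF ssum0]]])
       (rule order.trans[OF norm_triangle_ineq], simp add: norm_mult norm_power)
  moreover have "(\<Sum>n. real n * cmod (c n) * cmod z ^ n) \<le> C * cmod z ^ 2"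
    by (rule sums_le[OF _ summable_sums[OF ssum] Cz])
       (use term_le in \<open>simp add: norm_mult norm_power\<close>)
  ultimately show "cmod (z * deriv p z - p z) + cmod (z * deriv p z + p z) \<le> 2 * C * cmod z ^ 2"
    by linarith
  have "cmod (z * deriv p z) \<le> C * cmod z ^ 2"
    by (rule bound[OF sD Cz term_le])
  moreover have "deriv p 0 = 0"
  proof -
    have "(\<lambda>n. diffs c n * 0 ^ n) sums deriv p 0"
      by (rule termdiffs_sums_strong[OF p D]) auto
    then show ?thesis
      using c by (simp add: powser_sums_zero_iff diffs_def)
  qed
  ultimately show "cmod (deriv p z) \<le> C * cmod z"
    by (cases "z = 0") (auto simp: norm_mult power2_eq_square)
qed

text \<open>
  With \<open>H z = z + p z\<close> and \<open>N = z H' - cnj (z q')\<close>, the argument of \<open>F\<close> moves along a circle at the rate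
  \<open>Re (N / F)\<close>. This is positive iff \<open>|N - F| < |N + F|\<close>, which is the form that power series can prove: \<open>N + F\<close> is
  \<open>2 z\<close> plus a perturbation, \<open>N - F\<close> is a perturbation, and the moduli of both perturbations
  together are at most \<open>2 (C + D) |z|\<^sup>2 < 2 |z|\<close>. Injectivity holds because
  \<open>p + cnj q\<close> is a strict contraction on each smaller closed disk.
\<close>

lemma fully_starlike_if_coeff_sum_le_1:
  fixes c d :: "nat \<Rightarrow> complex"
  assumes F: "\<And>z. norm z < 1 \<Longrightarrow> F z = z + p z + cnj (q z)"
    and p: "\<And>z. norm z < 1 \<Longrightarrow> (\<lambda>n. c n * z ^ n) sums p z"
    and q: "\<And>z. norm z < 1 \<Longrightarrow> (\<lambda>n. d n * z ^ n) sums q z"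
    and c: "c 0 = 0" "c 1 = 0" and d: "d 0 = 0" "d 1 = 0"
    and C: "(\<lambda>n. real n * cmod (c n)) sums C"
    and D: "(\<lambda>n. real n * cmod (d n)) sums D"
    and CD: "C + D \<le> 1"
  shows "fully_starlike F"
proof -
  note p_bounds = power_series_Euler_bounds[OF p c C, simplified]
  note q_bounds = power_series_Euler_bounds[OF q d D, simplified]
  have p_hol: "p holomorphic_on unit_disk"
    by (rule power_series_holomorphic[of _ _ c]) (use p in simp)
  have q_hol: "q holomorphic_on unit_disk"
    by (rule power_series_holomorphic[of _ _ d]) (use q in simp)
  have C0: "C \<ge> 0" and D0: "D \<ge> 0"
    using sums_le[OF _ sums_zero C] sums_le[OF _ sums_zero D] by auto
  define H where "H = (\<lambda>z. z + p z)"
  have p': "(p has_field_derivative deriv p z) (at z)"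
    and q': "(q has_field_derivative deriv q z) (at z)" if "norm z < 1" for z
    using p_hol q_hol that
    by (auto intro!: holomorphic_derivI[of _ unit_disk])
  have H': "(H has_field_derivative 1 + deriv p z) (at z)" if "norm z < 1" for z
    unfolding H_def by (intro derivative_intros p' that)
  have p0: "p 0 = 0" and q0: "q 0 = 0"
    using p[of 0] q[of 0] c d by (auto simp: powser_sums_zero_iff)
  have rep: "harmonic_rep F H q"
    unfolding harmonic_rep_def
  proof (intro conjI ballI)
    show "H holomorphic_on unit_disk"
      unfolding H_def using p_hol by (intro holomorphic_intros)
    show "deriv H 0 = 1"
      using DERIV_imp_deriv[OF H'[of 0]] p_bounds(2)[of 0] by simp
  qed (use q_hol p0 q0 F in \<open>auto simp: H_def\<close>)
  have sense: "cmod (deriv q z) < cmod (deriv H z)" if "z \<in> unit_disk" for z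
  proof -
    have z: "norm z < 1" using that by simp
    have "cmod (deriv p z) + cmod (deriv q z) \<le> (C + D) * cmod z"
      using p_bounds(2)[OF z] q_bounds(2)[OF z] by (simp add: algebra_simps)
    also have "\<dots> \<le> 1 * cmod z"
      using CD by (intro mult_right_mono) auto
    finally have "cmod (deriv p z) + cmod (deriv q z) < 1"
      using z by simp
    moreover have "1 - cmod (deriv p z) \<le> cmod (1 + deriv p z)"
      using norm_diff_ineq[of 1 "deriv p z"] by simp
    ultimately show ?thesis
      using DERIV_imp_deriv[OF H'[OF z]] by simp
  qed
  have inj: "inj_on F unit_disk"
  proof (rule inj_onI, rule ccontr)
    fix z w :: complex
    assume z: "z \<in> unit_disk" and w: "w \<in> unit_disk" and eq: "F z = F w" and "z \<noteq> w"
    define \<rho> where "\<rho> = max (cmod z) (cmod w)"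
    have \<rho>: "0 \<le> \<rho>" "\<rho> < 1" using z w by (auto simp: \<rho>_def le_max_iff_disj)
    have zw: "z \<in> cball 0 \<rho>" "w \<in> cball 0 \<rho>" by (auto simp: \<rho>_def)
    have in_disk: "norm x < 1" if "x \<in> cball 0 \<rho>" for x :: complex
      using that \<rho> by auto
    have "cmod (p z - p w) \<le> C * \<rho> * cmod (z - w)"
    proof (rule field_differentiable_bound[OF convex_cball _ _ zw(1) zw(2)])
      fix x :: complex assume x: "x \<in> cball 0 \<rho>"
      show "(p has_field_derivative deriv p x) (at x within cball 0 \<rho>)"
        by (rule has_field_derivative_at_within[OF p'[OF in_disk[OF x]]])
      show "cmod (deriv p x) \<le> C * \<rho>"
        using p_bounds(2)[OF in_disk[OF x]] mult_left_mono[of "cmod x" \<rho> C] x C0 by auto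
    qed
    moreover have "cmod (q z - q w) \<le> D * \<rho> * cmod (z - w)"
    proof (rule field_differentiable_bound[OF convex_cball _ _ zw(1) zw(2)])
      fix x :: complex assume x: "x \<in> cball 0 \<rho>"
      show "(q has_field_derivative deriv q x) (at x within cball 0 \<rho>)"
        by (rule has_field_derivative_at_within[OF q'[OF in_disk[OF x]]])
      show "cmod (deriv q x) \<le> D * \<rho>"
        using q_bounds(2)[OF in_disk[OF x]] mult_left_mono[of "cmod x" \<rho> D] x D0 by auto
    qed
    moreover have "z - w = - (p z - p w) - cnj (q z - q w)"
      using eq F[of z] F[of w] z w by (simp add: algebra_simps)
    then have "cmod (z - w) \<le> cmod (p z - p w) + cmod (q z - q w)"
      by (metis complex_mod_cnj norm_minus_cancel norm_triangle_ineq4)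
    ultimately have "cmod (z - w) \<le> (C + D) * \<rho> * cmod (z - w)"
      by (simp add: algebra_simps)
    then have "1 \<le> (C + D) * \<rho>"
      using \<open>z \<noteq> w\<close> by simp
    moreover have "(C + D) * \<rho> \<le> 1 * \<rho>"
      using CD \<rho> by (intro mult_right_mono) auto
    ultimately show False using \<rho> by simp
  qed
  have arg: "\<exists>\<delta>>0. has_arg_derivative (\<lambda>t. F (of_real r * cis t)) \<delta> \<theta>"
    if r: "0 < r" "r < 1" for r \<theta> :: real
  proof -
    define z where "z = of_real r * cis \<theta>"
    have norm_z: "cmod z = r" using r by (simp add: z_def norm_mult)
    then have z: "norm z < 1" using r by simp
    define N where "N = z * (1 + deriv p z) - cnj (z * deriv q z)"
    have sum_eq: "N + F z = 2 * z + (z * deriv p z + p z) - cnj (z * deriv q z - q z)"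
      and diff_eq: "N - F z = (z * deriv p z - p z) - cnj (z * deriv q z + q z)"
      using F[OF z] by (simp_all add: N_def algebra_simps)
    have "cmod (N - F z) \<le> cmod (z * deriv p z - p z) + cmod (z * deriv q z + q z)"
      unfolding diff_eq by (rule order.trans[OF norm_triangle_ineq4]) (simp only: complex_mod_cnj order.refl)
    moreover have "2 * r - cmod (z * deriv p z + p z) - cmod (z * deriv q z - q z) \<le> cmod (N + F z)"
    proof -
      have "2 * z = (N + F z) - (z * deriv p z + p z) + cnj (z * deriv q z - q z)"
        unfolding sum_eq by simp
      then have "cmod (2 * z) \<le> cmod (N + F z) + cmod (z * deriv p z + p z) + cmod (cnj (z * deriv q z - q z))"
        by (metis add_right_mono norm_triangle_ineq norm_triangle_ineq4 order.trans)
      then show ?thesis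
        unfolding complex_mod_cnj by (simp add: norm_mult norm_z)
    qed
    ultimately have "2 * r - 2 * (C + D) * r ^ 2 \<le> cmod (N + F z) - cmod (N - F z)"
      using p_bounds(1)[OF z] q_bounds(1)[OF z] by (simp add: norm_z algebra_simps)
    moreover have "(C + D) * r ^ 2 \<le> 1 * r ^ 2"
      using CD by (intro mult_right_mono) auto
    moreover have "r ^ 2 < r"
      using r by (simp add: power2_eq_square)
    ultimately have "cmod (N - F z) < cmod (N + F z)"
      by linarith
    \<comment> \<open>\<open>|N + F|\<^sup>2 - |N - F|\<^sup>2 = 4 Re (N \<cdot> cnj F)\<close>\<close>
    then have "cmod (N - F z) ^ 2 < cmod (N + F z) ^ 2"
      by (intro power_strict_mono) auto
    then have "0 < Re N * Re (F z) + Im N * Im (F z)"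
      unfolding cmod_power2 by (simp add: power2_eq_square algebra_simps)
    moreover from this have nz: "F z \<noteq> 0"
      by auto
    ultimately have pos: "0 < Re (N / F z)"
      by (simp add: Re_divide complex_eq_iff sum_power2_gt_zero_iff)
    have circle: "((\<lambda>t. of_real r * cis t) has_vector_derivative \<i> * z) (at \<theta>)"
      unfolding z_def by (auto intro!: derivative_eq_intros simp: has_vector_derivative_def)
    have "(H \<circ> (\<lambda>t. of_real r * cis t) has_vector_derivative \<i> * z * (1 + deriv p z)) (at \<theta>)"
      by (rule field_vector_diff_chain_at[OF circle]) (use H'[OF z] in \<open>simp add: z_def\<close>)
    moreover have "(q \<circ> (\<lambda>t. of_real r * cis t) has_vector_derivative \<i> * z * deriv q z) (at \<theta>)"
      by (rule field_vector_diff_chain_at[OF circle]) (use q'[OF z] in \<open>simp add: z_def\<close>)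
    ultimately have "((\<lambda>t. H (of_real r * cis t) + cnj (q (of_real r * cis t)))
        has_vector_derivative \<i> * z * (1 + deriv p z) + cnj (\<i> * z * deriv q z)) (at \<theta>)"
      unfolding o_def by (intro has_vector_derivative_add has_vector_derivative_cnj)
    moreover have "H (of_real r * cis t) + cnj (q (of_real r * cis t)) = F (of_real r * cis t)" for t
      using F[of "of_real r * cis t"] r by (simp add: H_def norm_mult)
    moreover have "\<i> * z * (1 + deriv p z) + cnj (\<i> * z * deriv q z) = \<i> * N"
      by (simp add: N_def algebra_simps)
    ultimately have "((\<lambda>t. F (of_real r * cis t)) has_vector_derivative \<i> * N) (at \<theta>)"
      by simp
    then have "has_arg_derivative (\<lambda>t. F (of_real r * cis t)) (Im (\<i> * N / F z)) \<theta>"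
      unfolding z_def by (rule has_arg_derivativeI) (use nz in \<open>simp add: z_def\<close>)
    moreover have "Im (\<i> * N / F z) = Re (N / F z)"
      by (metis Im_i_times times_divide_eq_right)
    ultimately show ?thesis using pos by auto
  qed
  have "F \<in> class_S_H"
    unfolding class_S_H_def using inj rep sense by blast
  then show ?thesis
    unfolding fully_starlike_def using arg by (auto intro: inj_on_subset[OF inj])
qed

section \<open>The radius of full starlikeness\<close>

theorem corollary3p3:
  fixes lam :: real and \<epsilon> :: complex
    and f h g F :: "complex \<Rightarrow> complex" and a b :: "nat \<Rightarrow> complex"
  assumes "0 \<le> lam" and "lam \<le> 1" and "cmod \<epsilon> = 1"
    and "harmonic_rep f h g"
    and "\<And>z. z \<in> unit_disk \<Longrightarrow> (\<lambda>n. a (n + 2) * z ^ (n + 2)) sums (h z - z)"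
    and "\<And>z. z \<in> unit_disk \<Longrightarrow> (\<lambda>n. b (n + 2) * z ^ (n + 2)) sums g z"
    and "\<And>n. n \<ge> 2 \<Longrightarrow> cmod (a n) \<le> (2 * real n + 1) * (real n + 1) / 6"
    and "\<And>n. n \<ge> 2 \<Longrightarrow> cmod (b n) \<le> (2 * real n - 1) * (real n - 1) / 6"
    and "\<And>n. n \<ge> 2 \<Longrightarrow> \<bar>cmod (a n) - cmod (b n)\<bar> \<le> real n"
    and "F = (\<lambda>z. (1 - of_real lam) * f z + of_real lam * D_op \<epsilon> f z)"
  shows "(\<exists>!r. 0 < r \<and> r < 1 \<and> radius_poly lam r = 0) \<and>
    (\<forall>r_s. 0 < r_s \<and> r_s < 1 \<and> radius_poly lam r_s = 0 \<longrightarrow> fully_starlike_in r_s F)"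
proof (intro conjI allI impI)
  show "\<exists>!r. 0 < r \<and> r < 1 \<and> radius_poly lam r = 0"
    by (rule radius_poly_unique_root) fact+
next
  fix r assume "0 < r \<and> r < 1 \<and> radius_poly lam r = 0"
  then have r: "0 < r" "r < 1" and root: "radius_poly lam r = 0" by auto
  \<comment> \<open>Padding with zeros makes \<open>h z - z\<close> and \<open>g z\<close> power series indexed from \<open>0\<close>.\<close>
  define \<alpha> \<beta> where "\<alpha> n = (if n < 2 then 0 else a n)" and "\<beta> n = (if n < 2 then 0 else b n)" for n
  have hol: "h holomorphic_on unit_disk" "g holomorphic_on unit_disk"
    using assms(4) by (auto simp: harmonic_rep_def)
  have f: "f z = h z + cnj (g z)" if "norm z < 1" for z
    using assms(4) that by (auto simp: harmonic_rep_def)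
  have hs: "(\<lambda>n. \<alpha> n * z ^ n) sums (h z - z)" if "norm z < 1" for z
    using assms(5)[of z] that
    by (subst sums_zero_iff_shift[of 2, symmetric]) (simp_all add: \<alpha>_def)
  have gs: "(\<lambda>n. \<beta> n * z ^ n) sums g z" if "norm z < 1" for z
    using assms(6)[of z] that
    by (subst sums_zero_iff_shift[of 2, symmetric]) (simp_all add: \<beta>_def)
  have h': "((\<lambda>z. h z - z) has_field_derivative deriv h z - 1) (at z)"
    and g': "(g has_field_derivative deriv g z) (at z)" if "norm z < 1" for z
    using that hol by (auto intro!: derivative_intros holomorphic_derivI[of _ unit_disk])
  \<comment> \<open>Coefficients of the perturbation for \<open>z \<mapsto> F (r z) / r\<close>. The factor \<open>cnj \<epsilon>\<close> and the minus sign in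
    \<open>d\<close> come from moving \<open>- \<epsilon>\<close> under the conjugation of the co-analytic part.\<close>
  define c where "c n = of_real (1 - lam + lam * real n) * \<alpha> n * of_real r ^ n / of_real r" for n
  define d where "d n = (of_real (1 - lam) - of_real (lam * real n) * cnj \<epsilon>) * \<beta> n * of_real r ^ n / of_real r" for n
  define p where "p z = (let w = of_real r * z in
     ((1 - of_real lam) * (h w - w) + of_real lam * (w * (deriv h w - 1))) / of_real r)" for z
  define q where "q z = (let w = of_real r * z in
     ((1 - of_real lam) * g w - of_real lam * cnj \<epsilon> * (w * deriv g w)) / of_real r)" for z
  have in_disk: "norm (of_real r * z) < 1" if "norm z < 1" for z :: complex
    using that r mult_strict_mono[of r 1 "norm z" 1] by (simp add: norm_mult)
  have ps: "(\<lambda>n. c n * z ^ n) sums p z" if "norm z < 1" for z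
  proof -
    define w where "w = of_real r * z"
    have w: "norm w < 1" unfolding w_def by (rule in_disk) fact
    have "(\<lambda>n. ((1 - of_real lam) * (\<alpha> n * w ^ n) + of_real lam * (of_nat n * \<alpha> n * w ^ n)) / of_real r)
      sums (((1 - of_real lam) * (h w - w) + of_real lam * (w * (deriv h w - 1))) / of_real r)"
      by (intro sums_divide sums_add sums_mult hs euler_operator_sums[OF hs h'] w)
    then show ?thesis
      by (simp add: p_def Let_def w_def[symmetric] c_def)
         (simp add: w_def power_mult_distrib field_simps)
  qed
  have qs: "(\<lambda>n. d n * z ^ n) sums q z" if "norm z < 1" for z
  proof -
    define w where "w = of_real r * z"
    have w: "norm w < 1" unfolding w_def by (rule in_disk) fact
    have "(\<lambda>n. ((1 - of_real lam) * (\<beta> n * w ^ n) - of_real lam * cnj \<epsilon> * (of_nat n * \<beta> n * w ^ n)) / of_real r)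
      sums (((1 - of_real lam) * g w - of_real lam * cnj \<epsilon> * (w * deriv g w)) / of_real r)"
      by (intro sums_divide sums_diff sums_mult gs euler_operator_sums[OF gs g'] w)
    then show ?thesis
      by (simp add: q_def Let_def w_def[symmetric] d_def)
         (simp add: w_def power_mult_distrib field_simps)
  qed
  have F_eq: "F (of_real r * z) / of_real r = z + p z + cnj (q z)" if "norm z < 1" for z
  proof -
    define w where "w = of_real r * z"
    have w: "norm w < 1" unfolding w_def by (rule in_disk) fact
    have "F w = (1 - of_real lam) * (h w + cnj (g w))
        + of_real lam * (w * deriv h w - \<epsilon> * cnj (w * deriv g w))"
      using w assms(4) by (simp add: assms(10) f D_op_harmonic_rep[of f h g])
    also have "\<dots> = w + ((1 - of_real lam) * (h w - w) + of_real lam * (w * (deriv h w - 1)))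
       + cnj ((1 - of_real lam) * g w - of_real lam * cnj \<epsilon> * (w * deriv g w))"
      by (simp add: algebra_simps)
    finally have "F w / of_real r = w / of_real r + p z + cnj (q z)"
      by (simp add: p_def q_def Let_def w_def add_divide_distrib)
    then show ?thesis using r by (simp add: w_def)
  qed
  have "(\<lambda>n. majorant lam n * r ^ n) sums r"
    using majorant_sums[of r lam] r root by simp
  from sums_divide[OF this, of r] have M: "(\<lambda>n. majorant lam n * r ^ n / r) sums 1"
    using r by simp
  have coeff: "real n * cmod (c n) + real n * cmod (d n) \<le> majorant lam n * r ^ n / r" for n
  proof (cases "n < 2")
    case False
    let ?k = "1 - lam + lam * real n"
    have k: "?k \<ge> 0" using assms(1,2) by simp
    have "cmod (of_real (1 - lam) - of_real (lam * real n) * cnj \<epsilon>) \<le> ?k"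
      by (rule order.trans[OF norm_triangle_ineq4])
         (use assms(1,2,3) in \<open>simp only: norm_mult norm_of_real complex_mod_cnj, simp\<close>)
    then have "cmod (d n) \<le> ?k * cmod (b n) * r ^ n / r"
      using r False by (auto simp: d_def \<beta>_def norm_mult norm_divide norm_power
          intro!: divide_right_mono mult_right_mono)
    moreover have "cmod (c n) = ?k * cmod (a n) * r ^ n / r"
      using r False k unfolding c_def norm_divide norm_mult norm_power norm_of_real
      by (simp add: \<alpha>_def)
    ultimately have "cmod (c n) + cmod (d n) \<le> ?k * cmod (a n) * r ^ n / r + ?k * cmod (b n) * r ^ n / r"
      by linarith
    also have "\<dots> = (cmod (a n) + cmod (b n)) * (?k * r ^ n / r)"
      using r by (simp add: field_simps)
    also have "\<dots> \<le> ((2 * real n ^ 2 + 1) / 3) * (?k * r ^ n / r)"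
    proof (rule mult_right_mono)
      show "cmod (a n) + cmod (b n) \<le> (2 * real n ^ 2 + 1) / 3"
        using assms(7)[of n] assms(8)[of n] False by (simp add: field_simps power2_eq_square)
      show "0 \<le> ?k * r ^ n / r"
        using k r by (intro divide_nonneg_nonneg mult_nonneg_nonneg) auto
    qed
    finally have "real n * (cmod (c n) + cmod (d n)) \<le> real n * (((2 * real n ^ 2 + 1) / 3) * (?k * r ^ n / r))"
      by (intro mult_left_mono) auto
    then show ?thesis
      using False by (simp add: majorant_def field_simps)
  qed (auto simp: c_def d_def \<alpha>_def \<beta>_def majorant_def)
  have C: "summable (\<lambda>n. real n * cmod (c n))" and D: "summable (\<lambda>n. real n * cmod (d n))"
  proof -
    show "summable (\<lambda>n. real n * cmod (c n))"
      by (rule summable_comparison_test'[OF sums_summable[OF M], of 0])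
         (use order.trans[OF _ coeff] in auto)
    show "summable (\<lambda>n. real n * cmod (d n))"
      by (rule summable_comparison_test'[OF sums_summable[OF M], of 0])
         (use order.trans[OF _ coeff] in auto)
  qed
  have "(\<Sum>n. real n * cmod (c n)) + (\<Sum>n. real n * cmod (d n)) \<le> 1"
    by (rule sums_le[OF coeff sums_add[OF summable_sums[OF C] summable_sums[OF D]] M])
  then have "fully_starlike (\<lambda>z. F (of_real r * z) / of_real r)"
    by (intro fully_starlike_if_coeff_sum_le_1[OF F_eq ps qs _ _ _ _ summable_sums[OF C] summable_sums[OF D]])
       (auto simp: c_def d_def \<alpha>_def \<beta>_def)
  then show "fully_starlike_in r F"
    using r by (simp add: fully_starlike_in_def)
qed

end
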